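(* There exist absolute constants $C>0$ and $c>0$ such that the following holds. Let $K, M, N$ be positive integers with $M<N$, and let $\Phi$ be a real $M\times N$ matrix whose columns $\phi_1,\dots,\phi_N$ all have Euclidean norm $1$. Suppose that $\Phi$ satisfies the Restricted Isometry Property of order $[CK^{1.2}]$ with isometry constant $\delta=cK^{-0.2}$, and that $\Phi$ has coherence $\mu(\Phi)\le \frac{1}{20K^{0.8}}$. Then for any $K$-sparse $x\in\mathbb{R}^N$, Orthogonal Matching Pursuit applied to the input $(\Phi,y)$ with $y=\Phi x$ recovers $x$ exactly in at most $[CK^{1.2}]$ iterations, i.e. it stops at some iteration $l\le [CK^{1.2}]$ and its output is $\hat x=x$.
   Context: $[t]$ denotes the integer part of $t$, $\|\cdot\|$ the Euclidean norm and $\langle\cdot,\cdot\rangle$ the standard inner product. A vector is $K$-sparse if it has at most $K$ nonzero components; $\operatorname{supp}(z)$ is the set of indices of nonzero components of $z$. Coherence: $\mu(\Phi)=\sup_{i\ne j}|\langle\phi_i,\phi_j\rangle|$. Restricted Isometry Property (RIP): $\Phi$ satisfies the RIP of order $k$ with isometry constant $\delta\in(0,1)$ if $(1-\delta)\|z\|^2\le\|\Phi z\|^2\le(1+\delta)\|z\|^2$ for all $k$-sparse $z\in\mathbb{R}^N$. Orthogonal Matching Pursuit (OMP), on input $\Phi$, $y$: initialize $r^0=y$, $x^0=0$, $\Lambda^0=\emptyset$, $l=0$. If $r^l=0$, stop (at the $l$-th iteration) and output $\hat x=x^l$. Otherwise choose an index $i$ maximizing $|\langle r^l,\phi_i\rangle|$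 over $1\le i\le N$ (any maximizer in case of ties), put $\Lambda^{l+1}=\Lambda^l\cup\{i\}$, let $x^{l+1}$ be a minimizer of $\|y-\Phi z\|$ over all $z\in\mathbb{R}^N$ with $\operatorname{supp}(z)\subset\Lambda^{l+1}$, put $r^{l+1}=y-\Phi x^{l+1}$, and continue with $l+1$ in place of $l$. *)

theory Defs
  imports Complex_Main "Jordan_Normal_Form.Matrix"
begin

text \<open>Matrices and vectors have run-time dimensions, so that constants can be chosen before the
  dimensions. Columns and components are indexed from 0.\<close>

definition l2_norm :: "real vec \<Rightarrow> real" where
  "l2_norm v = sqrt (v \<bullet> v)"

definition supp :: "real vec \<Rightarrow> nat set" where
  "supp z = {i. i < dim_vec z \<and> z $ i \<noteq> 0}"

definition sparse :: "nat \<Rightarrow> real vec \<Rightarrow> bool" where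
  "sparse k z \<longleftrightarrow> card (supp z) \<le> k"

text \<open>The supremum is over a nonempty set only if there are at least two columns.\<close>

definition coherence :: "real mat \<Rightarrow> real" where
  "coherence \<Phi> = Sup {\<bar>col \<Phi> i \<bullet> col \<Phi> j\<bar> | i j. i < dim_col \<Phi> \<and> j < dim_col \<Phi> \<and> i \<noteq> j}"

definition RIP :: "real mat \<Rightarrow> nat \<Rightarrow> real \<Rightarrow> bool" where
  "RIP \<Phi> k \<delta> \<longleftrightarrow> 0 < \<delta> \<and> \<delta> < 1 \<and>
     (\<forall>z \<in> carrier_vec (dim_col \<Phi>). sparse k z \<longrightarrow>
        (1 - \<delta>) * (l2_norm z)\<^sup>2 \<le> (l2_norm (\<Phi> *\<^sub>v z))\<^sup>2 \<and>
        (l2_norm (\<Phi> *\<^sub>v z))\<^sup>2 \<le> (1 + \<delta>) * (l2_norm z)\<^sup>2)"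

text \<open>One iteration, as a relation: any maximizing index and any least-squares minimizer is
  allowed.\<close>

definition omp_step ::
    "real mat \<Rightarrow> real vec \<Rightarrow> real vec \<Rightarrow> nat set \<Rightarrow> real vec \<Rightarrow> real vec \<Rightarrow> nat set \<Rightarrow> bool" where
  "omp_step \<Phi> y r \<Lambda> r' x' \<Lambda>' \<longleftrightarrow>
     (\<exists>i. is_arg_max (\<lambda>i. \<bar>r \<bullet> col \<Phi> i\<bar>) (\<lambda>i. i < dim_col \<Phi>) i \<and> \<Lambda>' = \<Lambda> \<union> {i}) \<and>
     is_arg_min (\<lambda>z. l2_norm (y - \<Phi> *\<^sub>v z))
       (\<lambda>z. z \<in> carrier_vec (dim_col \<Phi>) \<and> supp z \<subseteq> \<Lambda>') x' \<and>
     r' = y - \<Phi> *\<^sub>v x'"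

text \<open>The sequences \<open>r\<close>, \<open>x\<close>, \<open>\<Lambda>\<close> record a run. After the first vanishing residual the
  algorithm has stopped, and the later entries carry no meaning.\<close>

definition omp_run ::
    "real mat \<Rightarrow> real vec \<Rightarrow> (nat \<Rightarrow> real vec) \<Rightarrow> (nat \<Rightarrow> real vec) \<Rightarrow> (nat \<Rightarrow> nat set) \<Rightarrow> bool" where
  "omp_run \<Phi> y r x \<Lambda> \<longleftrightarrow>
     r 0 = y \<and> x 0 = 0\<^sub>v (dim_col \<Phi>) \<and> \<Lambda> 0 = {} \<and>
     (\<forall>l. (\<forall>j\<le>l. r j \<noteq> 0\<^sub>v (dim_row \<Phi>)) \<longrightarrow>
        omp_step \<Phi> y (r l) (\<Lambda> l) (r (Suc l)) (x (Suc l)) (\<Lambda> (Suc l)))"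

definition omp_stops_at :: "real mat \<Rightarrow> (nat \<Rightarrow> real vec) \<Rightarrow> nat \<Rightarrow> bool" where
  "omp_stops_at \<Phi> r l \<longleftrightarrow> r l = 0\<^sub>v (dim_row \<Phi>) \<and> (\<forall>j<l. r j \<noteq> 0\<^sub>v (dim_row \<Phi>))"

end

theory Submission
  imports Defs
begin

text \<open>The argument is that of Zhang and Foucart. Let \<open>T\<close> be the set
  of support indices not yet selected. For every competitor \<open>z\<close> with at most \<open>p\<close> nonzero components
  outside the current selection, one iteration shrinks the excess of \<open>\<parallel>r\<parallel>\<^sup>2\<close> over
  \<open>\<parallel>y - \<Phi> z\<parallel>\<^sup>2\<close> by the factor \<open>1 - (1 - \<delta>) / p\<close>. Let \<open>E q\<close> be the energy of \<open>x\<close> on \<open>T\<close> without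
  its \<open>q\<close> largest components. A dyadic pigeonhole gives \<open>q\<close> and \<open>p = 2\<^sup>i \<le> 2 (q + 1)\<close> with
  \<open>E p \<le> E q / 4\<close> and \<open>E 0 \<le> 4\<^sup>i E q\<close>, so \<open>2 p (i + 1)\<close> iterations push \<open>\<parallel>r\<parallel>\<^sup>2\<close> below
  \<open>(1 - \<delta>) E q\<close>, which forces the selection of more than \<open>q\<close> new elements of \<open>T\<close>. Hence
  \<open>O(i + 1) = O(K\<^sup>0\<^sup>.\<^sup>2)\<close> iterations are spent per index found.\<close>

section \<open>Dyadic pigeonhole and numerical estimates\<close>

text \<open>The number \<open>e\<close> is the least value of \<open>sum f\<close> on a subset of \<open>T\<close> missing at most \<open>q\<close> elements,
  and \<open>V\<close> attains the corresponding minimum for \<open>2 ^ i\<close>.\<close>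

lemma dyadic_tail_selection:
  fixes f :: "'a \<Rightarrow> real"
  assumes fin: "finite T" and ne: "T \<noteq> {}" and pos: "\<And>j. j \<in> T \<Longrightarrow> 0 < f j"
  obtains q i V e where "q < card T" "2 ^ i \<le> 2 * (q + 1)" "V \<subseteq> T" "card (T - V) \<le> 2 ^ i"
    "0 < e" "4 * sum f V \<le> e" "sum f T \<le> 4 ^ i * e"
    "\<And>W. W \<subseteq> T \<Longrightarrow> card T \<le> card W + q \<Longrightarrow> e \<le> sum f W"
proof -
  define F where "F j = {V. V \<subseteq> T \<and> card T \<le> card V + j}" for j
  define E where "E j = Min (sum f ` F j)" for j
  \<comment> \<open>The scales are 0, 1, 2, 4, 8, ...; with 0 put in front,
    \<open>g (Suc i) = 2 ^ i\<close> is always at most \<open>2 * (g i + 1)\<close>.\<close>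
  define g :: "nat \<Rightarrow> nat" where "g i = (if i = 0 then 0 else 2 ^ (i - 1))" for i
  have finF: "finite (F j)" for j
    by (rule finite_subset[of _ "Pow T"]) (auto simp: F_def fin)
  have neF: "F j \<noteq> {}" for j by (auto simp: F_def)
  have E_le: "E j \<le> sum f W" if "W \<in> F j" for j W
    unfolding E_def using finF that by simp
  have E_attained: "\<exists>V \<in> F j. E j = sum f V" for j
    using Min_in[of "sum f ` F j"] finF[of j] neF[of j] unfolding E_def by fastforce
  have E0: "E 0 = sum f T"
  proof -
    have "F 0 = {T}" using card_seteq[OF fin] by (auto simp: F_def)
    then show ?thesis by (simp add: E_def)
  qed
  have E_nonneg: "0 \<le> E j" for j
  proof -
    obtain V where "V \<in> F j" "E j = sum f V" using E_attained by blast
    then show ?thesis using pos by (auto simp: F_def intro!: sum_nonneg dest: less_imp_le)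
  qed
  have E_big: "E j \<le> 0" if "card T \<le> j" for j
    using E_le[of "{}" j] that by (simp add: F_def)
  define P where "P i \<longleftrightarrow> 4 * E (g (Suc i)) \<le> E (g i)" for i
  \<comment> \<open>Some scale must satisfy \<open>P\<close>: since \<open>2 ^ n\<close> is at least
    \<open>n\<close>, the tail energy at scale \<open>g (Suc (card T))\<close> is zero.\<close>
  have "P (card T)"
  proof -
    have "card T \<le> g (Suc (card T))" by (simp add: g_def less_imp_le)
    from E_big[OF this] show ?thesis using E_nonneg[of "g (card T)"] unfolding P_def by linarith
  qed
  \<comment> \<open>At every scale before the first success the tail energy drops by a factor below
    4, so \<open>E 0\<close> is at most \<open>4 ^ i * E (g i)\<close>.\<close>
  define i where "i = (LEAST i. P i)"
  have Pi: "P i" unfolding i_def by (rule LeastI) fact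
  have grow: "E 0 \<le> 4 ^ j * E (g j)" if "j \<le> i" for j
    using that
  proof (induction j)
    case 0
    then show ?case by (simp add: g_def)
  next
    case (Suc j)
    have "\<not> P j" using Suc.prems not_less_Least[of j P] unfolding i_def by simp
    then have step: "E (g j) \<le> 4 * E (g (Suc j))" by (simp add: P_def)
    have "4 ^ j * E (g j) \<le> 4 ^ j * (4 * E (g (Suc j)))"
      using step by (intro mult_left_mono) auto
    also have "\<dots> = 4 ^ Suc j * E (g (Suc j))" by simp
    finally show ?case using Suc by linarith
  qed
  \<comment> \<open>Positivity passes from \<open>E 0\<close> to \<open>E (g i)\<close>; it later
    forces \<open>g i < card T\<close>, because \<open>E\<close> is not positive from
    \<open>card T\<close> on.\<close>
  have "0 < E 0" unfolding E0 using fin ne pos by (intro sum_pos) auto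
  then have "0 < 4 ^ i * E (g i)" using grow[of i] by simp
  then have epos: "0 < E (g i)" by (simp add: zero_less_mult_iff)
  obtain V where V: "V \<in> F (g (Suc i))" "E (g (Suc i)) = sum f V" using E_attained by blast
  show ?thesis
  proof (rule that[of "g i" i V "E (g i)"])
    show "g i < card T" using E_big[of "g i"] epos by linarith
    show "(2::nat) ^ i \<le> 2 * (g i + 1)" by (cases i) (auto simp: g_def)
    show "V \<subseteq> T" using V by (simp add: F_def)
    then show "card (T - V) \<le> 2 ^ i" using V fin
      by (simp add: F_def g_def card_Diff_subset finite_subset)
    show "4 * sum f V \<le> E (g i)" using Pi V by (simp add: P_def)
    show "sum f T \<le> 4 ^ i * E (g i)" using grow[of i] E0 by simp
    show "E (g i) \<le> sum f W" if "W \<subseteq> T" "card T \<le> card W + g i" for W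
      using that by (intro E_le) (simp add: F_def)
  qed (fact epos)
qed

text \<open>Each step multiplies the excess over \<open>B\<close> by at most
  \<open>1 - \<rho>\<close>. The excess may have either sign; nonnegativity of
  \<open>1 - \<rho>\<close> is what lets the bounds be chained.\<close>

lemma geometric_decay:
  fixes a :: "nat \<Rightarrow> real"
  assumes "\<rho> \<le> 1"
    and "\<And>j. j < k \<Longrightarrow> a (Suc j) \<le> a j - \<rho> * (a j - B)"
  shows "a k - B \<le> (1 - \<rho>) ^ k * (a 0 - B)"
  using assms(2)
proof (induction k)
  case (Suc k)
  have "a (Suc k) - B \<le> (1 - \<rho>) * (a k - B)" using Suc.prems[of k] by (simp add: algebra_simps)
  also have "\<dots> \<le> (1 - \<rho>) * ((1 - \<rho>) ^ k * (a 0 - B))"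
    using Suc assms(1) by (intro mult_left_mono) auto
  finally show ?case by simp
qed simp

text \<open>By 1 - t \<le> exp(-t) the power is at most
  \<open>exp (- (2 * (1 - \<delta>))) ^ i\<close>. Since \<open>2 * (1 - \<delta>)\<close> is at
  least 1.8 and exp 1.8 exceeds 4, every \<open>2 * p\<close> iterations gain a factor 4.\<close>

lemma contraction_power_le:
  fixes p :: real
  assumes "0 \<le> \<delta>" "\<delta> \<le> 1 / 10" "1 \<le> p" "real k = 2 * p * real i"
  shows "(1 - (1 - \<delta>) / p) ^ k \<le> (1 / 4) ^ i"
proof -
  have "(1 - (1 - \<delta>) / p) ^ k \<le> exp (- ((1 - \<delta>) / p)) ^ k"
    using assms exp_ge_add_one_self[of "- ((1 - \<delta>) / p)"]
    by (intro power_mono) (auto simp: divide_le_eq)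
  also have "\<dots> = exp (- (2 * (1 - \<delta>))) ^ i"
    using assms by (simp add: exp_of_nat_mult[symmetric]) (simp add: field_simps)
  also have "\<dots> \<le> (1 / 4) ^ i"
  proof (rule power_mono)
    have "(4::real) \<le> 1 + 1.8 + 1.8\<^sup>2 / 2" by (simp add: power2_eq_square)
    also have "\<dots> \<le> exp 1.8" by (rule exp_lower_Taylor_quadratic) simp
    also have "\<dots> \<le> exp (2 * (1 - \<delta>))" using assms by simp
    finally show "exp (- (2 * (1 - \<delta>))) \<le> 1 / 4"
      unfolding exp_minus by (simp add: inverse_eq_divide divide_le_eq)
  qed simp
  finally show ?thesis .
qed

text \<open>The number of dyadic scales is logarithmic in \<open>K\<close> and is absorbed here into
  a multiple of \<open>K powr 0.2\<close>.\<close>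

lemma Suc_le_powr_fifth:
  assumes "2 ^ i \<le> 2 * K"
  shows "real (Suc i) \<le> 12 * real K powr 0.2"
proof -
  have "0 < K" using assms by (cases K) auto
  have K: "2 powr (real i - 1) \<le> real K"
  proof -
    have "2 powr (real i - 1) = 2 ^ i / 2" by (simp add: powr_diff powr_realpow)
    also have "(2::real) ^ i / 2 \<le> real K" using of_nat_mono[OF assms, where ?'a=real] by simp
    finally show ?thesis by simp
  qed
  have "(1/2::real) \<le> ln 2" using ln_le_minus_one[of "1/2"] by (simp add: ln_div)
  \<comment> \<open>The factor 12 makes the slope \<open>12 * 0.2 * ln 2\<close> at least 1.2, using
    only that ln 2 is at least 1/2. For \<open>i = 0\<close> the term \<open>real i - 1\<close> is
    negative and ln 2 \<le> 1 is used instead.\<close>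
  have "real (Suc i) \<le> 12 * (1 + 0.2 * (real i - 1) * ln 2)"
  proof (cases i)
    case 0
    then show ?thesis using ln_le_minus_one[of 2] by simp
  next
    case (Suc n)
    have "real n * (1/2) \<le> real n * ln 2" using \<open>1/2 \<le> ln 2\<close> by (intro mult_left_mono) auto
    then show ?thesis using Suc by simp
  qed
  also have "\<dots> \<le> 12 * exp (0.2 * (real i - 1) * ln 2)" by (intro mult_left_mono exp_ge_add_one_self) auto
  also have "\<dots> = 12 * (2 powr (real i - 1)) powr 0.2" by (simp add: powr_powr) (simp add: powr_def algebra_simps)
  also have "\<dots> \<le> 12 * real K powr 0.2" using K by (intro mult_left_mono powr_mono2) auto
  finally show ?thesis .
qed


section \<open>Euclidean norm and inner product identities\<close>

lemma l2_norm_sq: "(l2_norm v)\<^sup>2 = v \<bullet> v"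
  unfolding l2_norm_def by (simp add: scalar_prod_def sum_nonneg)

lemma l2_norm_sq_sum: "v \<in> carrier_vec n \<Longrightarrow> (l2_norm v)\<^sup>2 = (\<Sum>j<n. (v $ j)\<^sup>2)"
  unfolding l2_norm_sq by (simp add: scalar_prod_def power2_eq_square atLeast0LessThan)

lemma l2_norm_sq_eq_0: "v \<in> carrier_vec n \<Longrightarrow> (l2_norm v)\<^sup>2 \<le> 0 \<Longrightarrow> v = 0\<^sub>v n"
  using sum_nonneg_eq_0_iff[of "{..<n}" "\<lambda>j. (v $ j)\<^sup>2"] sum_nonneg[of "{..<n}" "\<lambda>j. (v $ j)\<^sup>2"]
  by (intro eq_vecI) (auto simp: l2_norm_sq_sum order_antisym)

lemma l2_norm_nonneg: "0 \<le> l2_norm v"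
  unfolding l2_norm_def by (simp add: scalar_prod_def sum_nonneg)

lemma l2_norm_diff_sq:
  assumes "r \<in> carrier_vec n" "w \<in> carrier_vec n"
  shows "(l2_norm (r - w))\<^sup>2 = (l2_norm r)\<^sup>2 - 2 * (r \<bullet> w) + (l2_norm w)\<^sup>2"
proof -
  have "((r - w) $ j)\<^sup>2 = (r $ j)\<^sup>2 - 2 * (r $ j * w $ j) + (w $ j)\<^sup>2" if "j < n" for j
  proof -
    have "(r - w) $ j = r $ j - w $ j" using that assms(2) by (intro index_minus_vec) auto
    then show ?thesis by (simp add: power2_diff)
  qed
  then have "(l2_norm (r - w))\<^sup>2 = (\<Sum>j<n. (r $ j)\<^sup>2 - 2 * (r $ j * w $ j) + (w $ j)\<^sup>2)"
    unfolding l2_norm_sq_sum[OF minus_carrier_vec[OF assms]]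
    by (intro sum.cong) auto
  also have "\<dots> = (l2_norm r)\<^sup>2 - 2 * (r \<bullet> w) + (l2_norm w)\<^sup>2"
    using assms(2) by (simp add: l2_norm_sq_sum[OF assms(1)] l2_norm_sq_sum[OF assms(2)] scalar_prod_def
      sum.distrib sum_subtractf sum_distrib_left atLeast0LessThan)
  finally show ?thesis .
qed

lemma scalar_prod_mult_mat_vec:
  fixes \<Phi> :: "real mat"
  assumes "r \<in> carrier_vec M" "\<Phi> \<in> carrier_mat M N" "w \<in> carrier_vec N"
  shows "r \<bullet> (\<Phi> *\<^sub>v w) = (\<Sum>j<N. w $ j * (r \<bullet> col \<Phi> j))"
proof -
  have "vec N (\<lambda>j. r \<bullet> col \<Phi> j) \<bullet> w = r \<bullet> (\<Phi> *\<^sub>v w)"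
    using assoc_scalar_prod[OF assms] assms by (simp add: mult_mat_vec_def)
  then show ?thesis using assms
    by (auto simp: scalar_prod_def[of "vec N _"] atLeast0LessThan mult.commute intro!: sum.cong)
qed

section \<open>Least squares on a prescribed support\<close>

text \<open>The minimizer clause of \<open>omp_step\<close>, detached from any run. The facts below
  hold for every minimizer, so ties need no separate treatment.\<close>

definition least_squares :: "real mat \<Rightarrow> real vec \<Rightarrow> nat set \<Rightarrow> real vec \<Rightarrow> bool" where
  "least_squares \<Phi> y \<Lambda> z \<longleftrightarrow>
     is_arg_min (\<lambda>z. l2_norm (y - \<Phi> *\<^sub>v z)) (\<lambda>z. z \<in> carrier_vec (dim_col \<Phi>) \<and> supp z \<subseteq> \<Lambda>) z"

lemma least_squares_carrier: "least_squares \<Phi> y \<Lambda> z \<Longrightarrow> z \<in> carrier_vec (dim_col \<Phi>)"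
  and least_squares_supp: "least_squares \<Phi> y \<Lambda> z \<Longrightarrow> supp z \<subseteq> \<Lambda>"
  by (auto simp: least_squares_def is_arg_min_def)

lemma least_squares_le:
  assumes "least_squares \<Phi> y \<Lambda> z" "w \<in> carrier_vec (dim_col \<Phi>)" "supp w \<subseteq> \<Lambda>"
  shows "(l2_norm (y - \<Phi> *\<^sub>v z))\<^sup>2 \<le> (l2_norm (y - \<Phi> *\<^sub>v w))\<^sup>2"
  using assms by (intro power_mono l2_norm_nonneg) (auto simp: least_squares_def is_arg_min_linorder)

text \<open>The competitor obtained from \<open>z\<close> by adding t = \<langle>r, \<phi>\<rangle>
  in coordinate \<open>i\<close>, where \<phi> is column \<open>i\<close> and r the old residual, is
  admissible for \<open>z'\<close>. Its residual r - t\<phi> has squared norm reduced by exactly t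
  squared, as \<phi> is a unit vector.\<close>

lemma least_squares_decrease:
  assumes \<Phi>: "\<Phi> \<in> carrier_mat M N" and y: "y \<in> carrier_vec M"
    and i: "i < N" "l2_norm (col \<Phi> i) = 1"
    and z: "least_squares \<Phi> y \<Lambda> z" and z': "least_squares \<Phi> y (\<Lambda> \<union> {i}) z'"
  shows "(l2_norm (y - \<Phi> *\<^sub>v z'))\<^sup>2 \<le>
    (l2_norm (y - \<Phi> *\<^sub>v z))\<^sup>2 - ((y - \<Phi> *\<^sub>v z) \<bullet> col \<Phi> i)\<^sup>2"
proof -
  define r where "r = y - \<Phi> *\<^sub>v z"
  define t where "t = r \<bullet> col \<Phi> i"
  have zN: "z \<in> carrier_vec N" using least_squares_carrier[OF z] \<Phi> by simp
  have r: "r \<in> carrier_vec M" using \<Phi> y zN by (simp add: r_def)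
  have ci: "col \<Phi> i \<in> carrier_vec M" using \<Phi> by auto
  define w where "w = z + t \<cdot>\<^sub>v unit_vec N i"
  have w: "w \<in> carrier_vec N" using zN by (simp add: w_def)
  have "supp w \<subseteq> \<Lambda> \<union> {i}"
  proof
    fix j assume "j \<in> supp w"
    then have "j < N" "w $ j \<noteq> 0" using w by (auto simp: supp_def)
    then have "j = i \<or> j \<in> supp z" using zN i(1) by (auto simp: w_def supp_def)
    then show "j \<in> \<Lambda> \<union> {i}" using least_squares_supp[OF z] by auto
  qed
  moreover have "\<Phi> *\<^sub>v unit_vec N i = col \<Phi> i"
    using \<Phi> i by (intro eq_vecI) auto
  then have "\<Phi> *\<^sub>v w = \<Phi> *\<^sub>v z + t \<cdot>\<^sub>v col \<Phi> i"
    using \<Phi> zN unfolding w_def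
    by (simp add: mult_add_distrib_mat_vec[OF \<Phi>] mult_mat_vec[OF \<Phi>])
  then have "y - \<Phi> *\<^sub>v w = r - t \<cdot>\<^sub>v col \<Phi> i"
    using \<Phi> zN y ci unfolding r_def by (intro eq_vecI) auto
  moreover have "(l2_norm (r - t \<cdot>\<^sub>v col \<Phi> i))\<^sup>2 = (l2_norm r)\<^sup>2 - t\<^sup>2"
  proof -
    have "(l2_norm (t \<cdot>\<^sub>v col \<Phi> i))\<^sup>2 = t\<^sup>2 * (l2_norm (col \<Phi> i))\<^sup>2"
      using ci unfolding l2_norm_sq by (simp add: power2_eq_square)
    moreover have "r \<bullet> (t \<cdot>\<^sub>v col \<Phi> i) = t\<^sup>2"
      using r ci by (simp add: t_def power2_eq_square)
    ultimately show ?thesis using r ci i(2) l2_norm_diff_sq[of r M "t \<cdot>\<^sub>v col \<Phi> i"]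
      by (simp del: scalar_prod_smult_right scalar_prod_smult_distrib)
  qed
  ultimately show ?thesis
    using least_squares_le[OF z', of w] w \<Phi> by (simp add: r_def t_def)
qed

text \<open>For \<open>i\<close> already in \<open>\<Lambda>\<close> the enlarged support is
  \<open>\<Lambda>\<close> itself, so \<open>z\<close> is compared with itself and the guaranteed
  decrease must vanish.\<close>

lemma least_squares_orthogonal:
  assumes "\<Phi> \<in> carrier_mat M N" "y \<in> carrier_vec M" "i < N" "l2_norm (col \<Phi> i) = 1"
    and z: "least_squares \<Phi> y \<Lambda> z" and "i \<in> \<Lambda>"
  shows "(y - \<Phi> *\<^sub>v z) \<bullet> col \<Phi> i = 0"
  using least_squares_decrease[OF assms(1-5), of z] z \<open>i \<in> \<Lambda>\<close> by (simp add: insert_absorb)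

text \<open>Expanding the square and applying \<open>lower\<close> splits the gain into terms, one
  per coordinate. After multiplication by \<open>\<kappa>\<close>, completing the square bounds a
  term by the squared correlation, hence by \<open>g\<^sup>2\<close>, on \<open>U\<close>. Off
  \<open>U\<close> a term is at most 0, since the correlation or the entry of \<open>w\<close>
  vanishes. Only \<open>card U\<close> terms are therefore paid for.\<close>

lemma correlation_bound:
  assumes \<Phi>: "\<Phi> \<in> carrier_mat M N" and r: "r \<in> carrier_vec M" and w: "w \<in> carrier_vec N"
    and lower: "\<kappa> * (l2_norm w)\<^sup>2 \<le> (l2_norm (\<Phi> *\<^sub>v w))\<^sup>2" and "0 \<le> \<kappa>"
    and supp: "supp w \<subseteq> \<Lambda> \<union> U" and "finite U"
    and orth: "\<And>j. j < N \<Longrightarrow> j \<in> \<Lambda> \<Longrightarrow> r \<bullet> col \<Phi> j = 0"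
    and bound: "\<And>j. j < N \<Longrightarrow> \<bar>r \<bullet> col \<Phi> j\<bar> \<le> g"
  shows "\<kappa> * ((l2_norm r)\<^sup>2 - (l2_norm (r - \<Phi> *\<^sub>v w))\<^sup>2) \<le> real (card U) * g\<^sup>2"
proof -
  define c where "c j = r \<bullet> col \<Phi> j" for j
  have "(l2_norm r)\<^sup>2 - (l2_norm (r - \<Phi> *\<^sub>v w))\<^sup>2 = 2 * (r \<bullet> (\<Phi> *\<^sub>v w)) - (l2_norm (\<Phi> *\<^sub>v w))\<^sup>2"
    using l2_norm_diff_sq[OF r, of "\<Phi> *\<^sub>v w"] \<Phi> w by simp
  also have "\<dots> \<le> 2 * (r \<bullet> (\<Phi> *\<^sub>v w)) - \<kappa> * (l2_norm w)\<^sup>2" using lower by simp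
  also have "\<dots> = (\<Sum>j<N. 2 * (w $ j * c j) - \<kappa> * (w $ j)\<^sup>2)"
    unfolding scalar_prod_mult_mat_vec[OF r \<Phi> w] l2_norm_sq_sum[OF w] c_def
    by (simp add: sum_subtractf sum_distrib_left)
  finally have "\<kappa> * ((l2_norm r)\<^sup>2 - (l2_norm (r - \<Phi> *\<^sub>v w))\<^sup>2)
      \<le> \<kappa> * (\<Sum>j<N. 2 * (w $ j * c j) - \<kappa> * (w $ j)\<^sup>2)"
    using \<open>0 \<le> \<kappa>\<close> by (rule mult_left_mono)
  also have "\<dots> = (\<Sum>j<N. \<kappa> * (2 * (w $ j * c j) - \<kappa> * (w $ j)\<^sup>2))" by (rule sum_distrib_left)
  also have "\<dots> \<le> (\<Sum>j<N. if j \<in> U then g\<^sup>2 else 0)"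
  proof (rule sum_mono)
    fix j assume "j \<in> {..<N}"
    then have j: "j < N" by simp
    show "\<kappa> * (2 * (w $ j * c j) - \<kappa> * (w $ j)\<^sup>2) \<le> (if j \<in> U then g\<^sup>2 else 0)"
    proof (cases "j \<in> U")
      case True
      have "\<kappa> * (2 * (w $ j * c j) - \<kappa> * (w $ j)\<^sup>2) = (c j)\<^sup>2 - (\<kappa> * w $ j - c j)\<^sup>2"
        by (simp add: power2_eq_square algebra_simps)
      also have "\<dots> \<le> (c j)\<^sup>2" by simp
      also have "\<dots> \<le> g\<^sup>2" using bound[OF j] by (simp add: c_def abs_le_square_iff[symmetric])
      finally show ?thesis using True by simp
    next
      case False
      then have "j \<in> \<Lambda> \<or> w $ j = 0" using supp w j by (auto simp: supp_def)
      then have "w $ j * c j = 0" using orth[OF j] by (auto simp: c_def)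
      moreover have "0 \<le> \<kappa> * (\<kappa> * (w $ j)\<^sup>2)" using \<open>0 \<le> \<kappa>\<close> by simp
      ultimately show ?thesis using False by (auto simp: right_diff_distrib)
    qed
  qed
  also have "\<dots> = real (card ({..<N} \<inter> U)) * g\<^sup>2" by (simp add: sum.If_cases Int_def)
  also have "\<dots> \<le> real (card U) * g\<^sup>2"
    using \<open>finite U\<close> by (intro mult_right_mono) (auto intro!: card_mono)
  finally show ?thesis .
qed


section \<open>Invariants of a run and energy estimates before it stops\<close>

text \<open>Nonvanishing is demanded only for \<open>j < l\<close>, so the invariant also covers the
  iteration at which the residual first vanishes. In the base case the zero vector is the only one
  with empty support.\<close>

lemma omp_run_invariant:
  assumes run: "omp_run \<Phi> y rs xs \<Lambda>s" and \<Phi>: "\<Phi> \<in> carrier_mat M N" and y: "y \<in> carrier_vec M"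
    and nz: "\<And>j. j < l \<Longrightarrow> rs j \<noteq> 0\<^sub>v M"
  shows "least_squares \<Phi> y (\<Lambda>s l) (xs l) \<and> rs l = y - \<Phi> *\<^sub>v xs l \<and>
    finite (\<Lambda>s l) \<and> card (\<Lambda>s l) \<le> l"
  using nz
proof (induction l)
  case 0
  have "supp z \<subseteq> {} \<longleftrightarrow> z = 0\<^sub>v N" if "z \<in> carrier_vec N" for z
    using that by (auto simp: supp_def intro!: eq_vecI)
  moreover have "\<Phi> *\<^sub>v 0\<^sub>v N = 0\<^sub>v M" using \<Phi> by (intro eq_vecI) auto
  ultimately show ?case using run \<Phi> y
    by (auto simp: omp_run_def least_squares_def is_arg_min_linorder)
next
  case (Suc l)
  have "omp_step \<Phi> y (rs l) (\<Lambda>s l) (rs (Suc l)) (xs (Suc l)) (\<Lambda>s (Suc l))"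
    using run Suc.prems \<Phi> by (auto simp: omp_run_def)
  then show ?case using Suc.IH Suc.prems
    by (auto simp: omp_step_def least_squares_def card_insert_if)
qed

definition restrict_vec :: "nat set \<Rightarrow> real vec \<Rightarrow> real vec" where
  "restrict_vec A v = vec (dim_vec v) (\<lambda>j. if j \<in> A then v $ j else 0)"

text \<open>The setting of a proof by contradiction: the run is still going after \<open>L\<close>
  iterations. The RIP order \<open>K + L\<close> accommodates the support of \<open>x\<close>
  together with every selection made up to then.\<close>

locale unstopped_omp =
  fixes \<Phi> :: "real mat" and M N K L :: nat and \<delta> :: real and x :: "real vec"
    and rs xs :: "nat \<Rightarrow> real vec" and \<Lambda>s :: "nat \<Rightarrow> nat set"
  assumes \<Phi>: "\<Phi> \<in> carrier_mat M N"
    and unit: "\<And>i. i < N \<Longrightarrow> l2_norm (col \<Phi> i) = 1"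
    and RIP: "RIP \<Phi> (K + L) \<delta>" and \<delta>: "\<delta> \<le> 1 / 10"
    and x: "x \<in> carrier_vec N" and sparse: "sparse K x"
    and run: "omp_run \<Phi> (\<Phi> *\<^sub>v x) rs xs \<Lambda>s"
    and nonzero: "\<And>l. l \<le> L \<Longrightarrow> rs l \<noteq> 0\<^sub>v M"
begin

definition missing :: "nat \<Rightarrow> nat set" where "missing l = supp x - \<Lambda>s l"

definition energy :: "nat set \<Rightarrow> real" where "energy A = (\<Sum>j\<in>A. (x $ j)\<^sup>2)"

definition res :: "nat \<Rightarrow> real" where "res l = (l2_norm (rs l))\<^sup>2"

lemma delta_pos: "0 < \<delta>"
  using RIP by (simp add: RIP_def)

lemma RIP_bounds:
  assumes "z \<in> carrier_vec N" "supp z \<subseteq> A" "finite A" "card A \<le> K + L"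
  shows "(1 - \<delta>) * (l2_norm z)\<^sup>2 \<le> (l2_norm (\<Phi> *\<^sub>v z))\<^sup>2"
    and "(l2_norm (\<Phi> *\<^sub>v z))\<^sup>2 \<le> (1 + \<delta>) * (l2_norm z)\<^sup>2"
proof -
  have "sparse (K + L) z" using card_mono[OF assms(3,2)] assms(4) by (simp add: sparse_def)
  then show "(1 - \<delta>) * (l2_norm z)\<^sup>2 \<le> (l2_norm (\<Phi> *\<^sub>v z))\<^sup>2"
    and "(l2_norm (\<Phi> *\<^sub>v z))\<^sup>2 \<le> (1 + \<delta>) * (l2_norm z)\<^sup>2"
    using RIP assms(1) \<Phi> by (auto simp: RIP_def)
qed

lemma finite_supp: "finite (supp x)" and card_supp: "card (supp x) \<le> K"
  using sparse by (auto simp: supp_def sparse_def)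

lemma supp_bounded: "supp x \<subseteq> {..<N}"
  using x by (auto simp: supp_def)

lemma finite_missing: "finite (missing l)"
  using finite_supp by (simp add: missing_def)

lemma
  assumes "l \<le> L"
  shows ls: "least_squares \<Phi> (\<Phi> *\<^sub>v x) (\<Lambda>s l) (xs l)"
    and residual: "rs l = \<Phi> *\<^sub>v x - \<Phi> *\<^sub>v xs l"
    and finite_sel: "finite (\<Lambda>s l)"
    and card_sel: "card (\<Lambda>s l) \<le> l"
    and xs_carrier: "xs l \<in> carrier_vec N"
    and xs_supp: "supp (xs l) \<subseteq> \<Lambda>s l"
    and rs_carrier: "rs l \<in> carrier_vec M"
  using omp_run_invariant[OF run \<Phi>, of l] nonzero assms \<Phi> x
    least_squares_carrier[of \<Phi> "\<Phi> *\<^sub>v x" "\<Lambda>s l" "xs l"] least_squares_supp[of \<Phi> "\<Phi> *\<^sub>v x" "\<Lambda>s l" "xs l"]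
  by auto

lemma card_supp_sel:
  assumes "l \<le> L"
  shows "finite (supp x \<union> \<Lambda>s l)" "card (supp x \<union> \<Lambda>s l) \<le> K + L"
  using card_Un_le[of "supp x" "\<Lambda>s l"] card_supp card_sel[OF assms] finite_supp finite_sel[OF assms] assms
  by auto

lemma greedy_step:
  assumes "l < L"
  obtains i where "i < N" "\<Lambda>s (Suc l) = \<Lambda>s l \<union> {i}"
    "\<And>j. j < N \<Longrightarrow> \<bar>rs l \<bullet> col \<Phi> j\<bar> \<le> \<bar>rs l \<bullet> col \<Phi> i\<bar>"
proof -
  have "omp_step \<Phi> (\<Phi> *\<^sub>v x) (rs l) (\<Lambda>s l) (rs (Suc l)) (xs (Suc l)) (\<Lambda>s (Suc l))"
    using run nonzero assms \<Phi> by (auto simp: omp_run_def)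
  then show ?thesis using that \<Phi> by (auto simp: omp_step_def is_arg_max_linorder)
qed

lemma sel_mono: "l \<le> m \<Longrightarrow> m \<le> L \<Longrightarrow> \<Lambda>s l \<subseteq> \<Lambda>s m"
proof (induction m rule: dec_induct)
  case (step m)
  then show ?case using greedy_step[of m] by (metis Suc_le_eq le_supI1 less_imp_le)
qed simp

lemma restrict_facts:
  shows restrict_carrier: "restrict_vec A x \<in> carrier_vec N"
    and restrict_supp: "supp (restrict_vec A x) \<subseteq> A \<inter> supp x"
    and restrict_norm: "A \<subseteq> supp x \<Longrightarrow> (l2_norm (restrict_vec A x))\<^sup>2 = energy A"
proof -
  show car: "restrict_vec A x \<in> carrier_vec N" using x by (auto simp: restrict_vec_def)
  show "supp (restrict_vec A x) \<subseteq> A \<inter> supp x" by (auto simp: restrict_vec_def supp_def split: if_splits)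
  assume "A \<subseteq> supp x"
  then have "A = {..<N} \<inter> {j. j \<in> A}" using supp_bounded by auto
  then have "energy A = (\<Sum>j<N. if j \<in> A then (x $ j)\<^sup>2 else 0)"
    unfolding energy_def by (simp add: sum.If_cases)
  also have "\<dots> = (l2_norm (restrict_vec A x))\<^sup>2"
    unfolding l2_norm_sq_sum[OF car] using x by (intro sum.cong) (auto simp: restrict_vec_def)
  finally show "(l2_norm (restrict_vec A x))\<^sup>2 = energy A" ..
qed

lemma restrict_image_norm:
  assumes "A \<subseteq> supp x"
  shows "(l2_norm (\<Phi> *\<^sub>v restrict_vec A x))\<^sup>2 \<le> (1 + \<delta>) * energy A"
  using RIP_bounds(2)[OF restrict_carrier, of A "supp x"] restrict_supp[of A] finite_supp card_supp
    restrict_norm[OF assms] by auto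

text \<open>The difference \<open>x - xs l\<close> is sparse enough for the RIP and agrees with
  \<open>x\<close> on the missing indices, where \<open>xs l\<close> is zero.\<close>

lemma res_lower:
  assumes "l \<le> L"
  shows "(1 - \<delta>) * energy (missing l) \<le> res l"
proof -
  have car: "x - xs l \<in> carrier_vec N" using x xs_carrier[OF assms] by simp
  have "supp (x - xs l) \<subseteq> supp x \<union> \<Lambda>s l"
    using x xs_carrier[OF assms] xs_supp[OF assms] by (auto simp: supp_def)
  from RIP_bounds(1)[OF car this card_supp_sel[OF assms]]
  have "(1 - \<delta>) * (l2_norm (x - xs l))\<^sup>2 \<le> res l"
    unfolding res_def residual[OF assms]
    using mult_minus_distrib_mat_vec[OF \<Phi> x xs_carrier[OF assms]] by simp
  moreover have "energy (missing l) \<le> (l2_norm (x - xs l))\<^sup>2"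
  proof -
    have "energy (missing l) = (\<Sum>j\<in>missing l. ((x - xs l) $ j)\<^sup>2)"
      unfolding energy_def
    proof (rule sum.cong)
      fix j assume "j \<in> missing l"
      then have "j < N" "j \<notin> supp (xs l)"
        using supp_bounded xs_supp[OF assms] by (auto simp: missing_def)
      then show "(x $ j)\<^sup>2 = ((x - xs l) $ j)\<^sup>2"
        using xs_carrier[OF assms] by (auto simp: supp_def)
    qed simp
    also have "\<dots> \<le> (\<Sum>j<N. ((x - xs l) $ j)\<^sup>2)"
      using supp_bounded by (intro sum_mono2) (auto simp: missing_def)
    finally show ?thesis by (simp only: l2_norm_sq_sum[OF car])
  qed
  then have "(1 - \<delta>) * energy (missing l) \<le> (1 - \<delta>) * (l2_norm (x - xs l))\<^sup>2"
    using \<delta> by (intro mult_left_mono) auto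
  ultimately show ?thesis by linarith
qed

text \<open>The part of \<open>x\<close> on the selected indices competes in the least-squares
  problem, and its residual is the image of the missing part.\<close>

lemma res_upper:
  assumes "l \<le> L"
  shows "res l \<le> (1 + \<delta>) * energy (missing l)"
proof -
  let ?z = "restrict_vec (\<Lambda>s l) x" and ?u = "restrict_vec (missing l) x"
  have "x - ?z = ?u" using x
    by (intro eq_vecI) (auto simp: restrict_vec_def missing_def supp_def)
  then have "\<Phi> *\<^sub>v x - \<Phi> *\<^sub>v ?z = \<Phi> *\<^sub>v ?u"
    using mult_minus_distrib_mat_vec[OF \<Phi> x restrict_carrier[of "\<Lambda>s l"]] by simp
  then have "res l \<le> (l2_norm (\<Phi> *\<^sub>v ?u))\<^sup>2"
    using least_squares_le[OF ls[OF assms], of ?z] restrict_carrier restrict_supp[of "\<Lambda>s l"] \<Phi>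
    unfolding res_def residual[OF assms] by auto
  also have "\<dots> \<le> (1 + \<delta>) * energy (missing l)"
    by (rule restrict_image_norm) (auto simp: missing_def)
  finally show ?thesis .
qed

text \<open>The competitor is \<open>x\<close> without its part on \<open>V\<close>. It differs from
  \<open>xs l\<close> outside the selection in at most \<open>p\<close> places, so
  \<open>correlation_bound\<close> makes the largest correlation big, and
  \<open>least_squares_decrease\<close> turns its square into a drop of the residual.\<close>

lemma res_descent:
  assumes l: "l < L" and V: "V \<subseteq> supp x" and p: "card (missing l - V) \<le> p" "0 < p"
  shows "res (Suc l) \<le> res l - (1 - \<delta>) / real p * (res l - (1 + \<delta>) * energy V)"
proof -
  obtain i where i: "i < N" "\<Lambda>s (Suc l) = \<Lambda>s l \<union> {i}"
    and max: "\<And>j. j < N \<Longrightarrow> \<bar>rs l \<bullet> col \<Phi> j\<bar> \<le> \<bar>rs l \<bullet> col \<Phi> i\<bar>"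
    using greedy_step[OF l] by metis
  have l': "l \<le> L" "Suc l \<le> L" using l by auto
  have y: "\<Phi> *\<^sub>v x \<in> carrier_vec M" using \<Phi> x by simp
  note xl = xs_carrier[OF l'(1)]
  let ?v = "restrict_vec V x"
  \<comment> \<open>The displacement from \<open>xs l\<close> to the competitor: moving by
    \<open>w\<close> leaves exactly \<open>\<Phi> *\<^sub>v ?v\<close> as residual.\<close>
  define w where "w = x - ?v - xs l"
  have w: "w \<in> carrier_vec N" using x xl restrict_carrier by (simp add: w_def)
  have supp_w: "supp w \<subseteq> \<Lambda>s l \<union> (missing l - V)"
    using x xl xs_supp[OF l'(1)] by (auto simp: w_def supp_def restrict_vec_def missing_def split: if_splits)
  have "rs l - \<Phi> *\<^sub>v w = \<Phi> *\<^sub>v ?v"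
  proof -
    have "\<Phi> *\<^sub>v w = \<Phi> *\<^sub>v x - \<Phi> *\<^sub>v ?v - \<Phi> *\<^sub>v xs l"
      using mult_minus_distrib_mat_vec[OF \<Phi> _ xl, of "x - ?v"]
        mult_minus_distrib_mat_vec[OF \<Phi> x restrict_carrier[of V]] x restrict_carrier[of V]
      by (simp add: w_def)
    moreover have "\<Phi> *\<^sub>v ?v \<in> carrier_vec M" "\<Phi> *\<^sub>v xs l \<in> carrier_vec M"
      using \<Phi> restrict_carrier[of V] xl by auto
    ultimately show ?thesis using y unfolding residual[OF l'(1)] by (intro eq_vecI) auto
  qed
  then have B: "(l2_norm (rs l - \<Phi> *\<^sub>v w))\<^sup>2 \<le> (1 + \<delta>) * energy V"
    using restrict_image_norm[OF V] by simp
  have "supp w \<subseteq> supp x \<union> \<Lambda>s l" using supp_w by (auto simp: missing_def)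
  note lower = RIP_bounds(1)[OF w this card_supp_sel[OF l'(1)]]
  define g where "g = \<bar>rs l \<bullet> col \<Phi> i\<bar>"
  have "(1 - \<delta>) * (res l - (1 + \<delta>) * energy V)
      \<le> (1 - \<delta>) * (res l - (l2_norm (rs l - \<Phi> *\<^sub>v w))\<^sup>2)"
    using B \<delta> by (intro mult_left_mono) auto
  also have "\<dots> \<le> real (card (missing l - V)) * g\<^sup>2"
    unfolding res_def
  proof (rule correlation_bound[OF \<Phi> rs_carrier[OF l'(1)] w lower _ supp_w])
    show "rs l \<bullet> col \<Phi> j = 0" if "j < N" "j \<in> \<Lambda>s l" for j
      using least_squares_orthogonal[OF \<Phi> y that(1) unit[OF that(1)] ls[OF l'(1)] that(2)]
      by (simp add: residual[OF l'(1)])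
  qed (use max \<delta> finite_missing in \<open>auto simp: g_def\<close>)
  also have "\<dots> \<le> real p * g\<^sup>2" using p by (intro mult_right_mono) auto
  finally have "(1 - \<delta>) / real p * (res l - (1 + \<delta>) * energy V) \<le> g\<^sup>2"
    using p by (simp add: divide_le_eq mult.commute)
  moreover have "res (Suc l) \<le> res l - g\<^sup>2"
    using least_squares_decrease[OF \<Phi> y i(1) unit[OF i(1)] ls[OF l'(1)], of "xs (Suc l)"]
      ls[OF l'(2)] i(2) by (simp add: res_def residual[OF l'(1)] residual[OF l'(2)] g_def)
  ultimately show ?thesis by linarith
qed

section \<open>Amortized count of iterations per index found\<close>

text \<open>The invariant grants \<open>4 * D\<close> iterations for each of the
  \<open>K - card (missing n)\<close> units of progress. A stage of \<open>k\<close> iterations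
  finds at least \<open>q + 1\<close> new indices and costs at most \<open>4 * D * (q + 1)\<close>,
  so the budget is kept.\<close>

lemma stage:
  assumes D: "\<And>i. 2 ^ i \<le> 2 * K \<Longrightarrow> Suc i \<le> D" and L: "4 * D * K \<le> L"
    and n: "n \<le> 4 * D * (K - card (missing n))" and ne: "missing n \<noteq> {}"
  obtains n' where "card (missing n') < card (missing n)" "n' \<le> 4 * D * (K - card (missing n'))"
proof -
  define T where "T = missing n"
  have T: "T \<subseteq> supp x" by (auto simp: T_def missing_def)
  have finT: "finite T" by (simp add: T_def finite_missing)
  have cT: "card T \<le> K" using card_mono[OF finite_supp T] card_supp by simp
  have pos: "0 < (x $ j)\<^sup>2" if "j \<in> T" for j using that T by (auto simp: supp_def)
  obtain q i V e where q: "q < card T" "2 ^ i \<le> 2 * (q + 1)" and V: "V \<subseteq> T" "card (T - V) \<le> 2 ^ i"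
    and e: "0 < e" "4 * energy V \<le> e" "energy T \<le> 4 ^ i * e"
    and tail: "\<And>W. W \<subseteq> T \<Longrightarrow> card T \<le> card W + q \<Longrightarrow> e \<le> energy W"
    using dyadic_tail_selection[OF finT, of "\<lambda>j. (x $ j)\<^sup>2"] ne pos unfolding energy_def T_def by metis
  \<comment> \<open>With p = \<open>2 ^ i\<close> this is \<open>2 * p * Suc i\<close>:
    \<open>i\<close> of the factors 1/4 gained cancel the \<open>4 ^ i\<close> in the bound on
    \<open>energy T\<close>, and one is left over.\<close>
  define k :: nat where "k = 2 * 2 ^ i * Suc i"
  have "2 * (q + 1) \<le> 2 * K" using q(1) cT by simp
  then have "Suc i \<le> D" using q(2) order_trans D by blast
  then have "2 * 2 ^ i * Suc i \<le> 2 * (2 * (q + 1)) * D"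
    using q(2) by (intro mult_le_mono) auto
  then have k: "k \<le> 4 * D * (q + 1)" by (simp add: k_def algebra_simps)
  have "n + k \<le> 4 * D * (K - card T) + 4 * D * (q + 1)" using n k by (simp add: T_def)
  also have "\<dots> = 4 * D * (K - (card T - (q + 1)))"
  proof -
    have "K - (card T - (q + 1)) = K - card T + (q + 1)" using q cT by simp
    then show ?thesis by (simp only: distrib_left)
  qed
  finally have nk: "n + k \<le> 4 * D * (K - (card T - (q + 1)))" .
  also have "\<dots> \<le> 4 * D * K" by simp
  finally have nkL: "n + k \<le> L" using L by simp
  have \<delta>0: "0 < \<delta>" by (rule delta_pos)
  define B where "B = (1 + \<delta>) * energy V"
  have "0 \<le> B" using \<delta>0 by (simp add: B_def energy_def sum_nonneg)
  have "1 - \<delta> \<le> 2 ^ i" using \<delta>0 one_le_power[of "2::real" i] by linarith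
  then have ratio: "(1 - \<delta>) / 2 ^ i \<le> 1" by simp
  have "res (n + k) - B \<le> (1 - (1 - \<delta>) / 2 ^ i) ^ k * (res (n + 0) - B)"
  proof (rule geometric_decay)
    show "(1 - \<delta>) / 2 ^ i \<le> 1" by (rule ratio)
    fix j assume "j < k"
    then have j: "n + j < L" using nkL by simp
    \<comment> \<open>The target \<open>V\<close> stays fixed during the stage; selections only
      shrink the missing set, so the bound \<open>2 ^ i\<close> persists.\<close>
    have "missing (n + j) - V \<subseteq> T - V"
      using sel_mono[of n "n + j"] j by (auto simp: missing_def T_def)
    then have "card (missing (n + j) - V) \<le> 2 ^ i"
      using V(2) finT card_mono[of "T - V"] by (meson finite_Diff order_trans)
    from res_descent[OF j _ this] V T
    show "res (n + Suc j) \<le> res (n + j) - (1 - \<delta>) / 2 ^ i * (res (n + j) - B)"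
      by (auto simp: B_def)
  qed
  also have "\<dots> \<le> (1 - (1 - \<delta>) / 2 ^ i) ^ k * res n"
    using ratio \<open>0 \<le> B\<close> by (intro mult_left_mono zero_le_power) auto
  also have "\<dots> \<le> (1 / 4) ^ Suc i * res n"
    using \<delta>0 \<delta> by (intro mult_right_mono contraction_power_le) (auto simp: k_def res_def algebra_simps)
  also have "\<dots> \<le> (1 / 4) ^ Suc i * ((1 + \<delta>) * (4 ^ i * e))"
  proof (rule mult_left_mono)
    have "res n \<le> (1 + \<delta>) * energy T" using res_upper[of n] nkL by (simp add: T_def)
    also have "\<dots> \<le> (1 + \<delta>) * (4 ^ i * e)" using e \<delta>0 by (intro mult_left_mono) auto
    finally show "res n \<le> (1 + \<delta>) * (4 ^ i * e)" .
  qed simp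
  also have "\<dots> = (1 + \<delta>) * e / 4" by (simp add: power_divide field_simps)
  finally have "res (n + k) - B \<le> (1 + \<delta>) * e / 4" .
  moreover have "B \<le> (1 + \<delta>) * (e / 4)" unfolding B_def using e \<delta>0 by (intro mult_left_mono) auto
  \<comment> \<open>The decayed excess and the floor \<open>B\<close> contribute
    \<open>(1 + \<delta>) * e / 4\<close> each; the sum is below \<open>(1 - \<delta>) * e\<close>
    because \<open>\<delta>\<close> is less than 1/3.\<close>
  ultimately have "res (n + k) \<le> (1 + \<delta>) * e / 2" by simp
  also have "\<dots> < (1 - \<delta>) * e"
  proof -
    have "(1 + \<delta>) / 2 < 1 - \<delta>" using \<delta> by simp
    from mult_strict_right_mono[OF this e(1)] show ?thesis by simp
  qed
  finally have "(1 - \<delta>) * energy (missing (n + k)) < (1 - \<delta>) * e"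
    using res_lower[OF nkL] by simp
  then have "energy (missing (n + k)) < e" using \<delta> by simp
  moreover have "missing (n + k) \<subseteq> T" using sel_mono[of n "n + k"] nkL by (auto simp: missing_def T_def)
  \<comment> \<open>By \<open>tail\<close>, a subset of \<open>T\<close> with energy below
    \<open>e\<close> must lack more than \<open>q\<close> elements of \<open>T\<close>.\<close>
  ultimately have fewer: "card (missing (n + k)) + q < card T" using tail[of "missing (n + k)"] by force
  show ?thesis
  proof (rule that[of "n + k"])
    show "card (missing (n + k)) < card (missing n)" using fewer by (simp add: T_def)
    have "4 * D * (K - (card T - (q + 1))) \<le> 4 * D * (K - card (missing (n + k)))"
      using fewer by (intro mult_le_mono) auto
    then show "n + k \<le> 4 * D * (K - card (missing (n + k)))" using nk by linarith
  qed
qed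

text \<open>Among the iterations within budget take one with the fewest missing indices. By
  \<open>stage\<close> none are missing there, so \<open>res_upper\<close> makes the residual zero
  no later than iteration \<open>L\<close>.\<close>

lemma no_unstopped_run:
  assumes D: "\<And>i. 2 ^ i \<le> 2 * K \<Longrightarrow> Suc i \<le> D" and L: "4 * D * K \<le> L"
  shows False
proof -
  define P where "P n \<longleftrightarrow> n \<le> 4 * D * (K - card (missing n))" for n
  have "P 0" by (simp add: P_def)
  then obtain n where n: "P n" and least: "\<And>m. P m \<Longrightarrow> card (missing n) \<le> card (missing m)"
    using exists_least_iff[of "\<lambda>c. \<exists>n. P n \<and> card (missing n) = c"] by (metis linorder_not_less)
  have "missing n = {}"
  proof (rule ccontr)
    assume "missing n \<noteq> {}"
    then show False using stage[OF D L] n least unfolding P_def by (metis linorder_not_less)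
  qed
  have "n \<le> 4 * D * K" using n diff_le_self[of K] mult_le_mono2[of "K - card (missing n)" K "4 * D"]
    unfolding P_def by linarith
  then have nL: "n \<le> L" using L by simp
  have "res n \<le> 0" using res_upper[OF nL] \<open>missing n = {}\<close> by (simp add: energy_def)
  then have "rs n = 0\<^sub>v M" unfolding res_def using rs_carrier[OF nL] by (rule l2_norm_sq_eq_0[rotated])
  then show False using nonzero[OF nL] by simp
qed

end

section \<open>Exact recovery and choice of the constants\<close>

lemma RIP_mono: "RIP \<Phi> s \<delta> \<Longrightarrow> t \<le> s \<Longrightarrow> RIP \<Phi> t \<delta>"
  by (auto simp: RIP_def sparse_def)

text \<open>At the first vanishing residual, \<open>x - xs l\<close> lies in the kernel of
  \<open>\<Phi>\<close> and has at most \<open>K + 4 * D * K\<close> nonzero entries, so the lower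
  RIP bound forces it to be zero.\<close>

lemma omp_recovers:
  assumes \<Phi>: "\<Phi> \<in> carrier_mat M N" and unit: "\<And>i. i < N \<Longrightarrow> l2_norm (col \<Phi> i) = 1"
    and RIP: "RIP \<Phi> (K + 4 * D * K) \<delta>" and \<delta>: "\<delta> \<le> 1 / 10"
    and x: "x \<in> carrier_vec N" and sp: "sparse K x"
    and run: "omp_run \<Phi> (\<Phi> *\<^sub>v x) rs xs \<Lambda>s"
    and D: "\<And>i. 2 ^ i \<le> 2 * K \<Longrightarrow> Suc i \<le> D"
  shows "\<exists>l \<le> 4 * D * K. omp_stops_at \<Phi> rs l \<and> xs l = x"
proof -
  have "\<exists>l \<le> 4 * D * K. rs l = 0\<^sub>v M"
  proof (rule ccontr)
    assume "\<not> ?thesis"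
    then interpret unstopped_omp \<Phi> M N K "4 * D * K" \<delta> x rs xs \<Lambda>s
      using assms by unfold_locales auto
    show False by (rule no_unstopped_run[OF D]) auto
  qed
  then obtain l where l: "l \<le> 4 * D * K" "rs l = 0\<^sub>v M" and before: "\<And>j. j < l \<Longrightarrow> rs j \<noteq> 0\<^sub>v M"
    using exists_least_iff[of "\<lambda>l. l \<le> 4 * D * K \<and> rs l = 0\<^sub>v M"] by (metis less_le_trans less_imp_le)
  have inv: "least_squares \<Phi> (\<Phi> *\<^sub>v x) (\<Lambda>s l) (xs l)" "rs l = \<Phi> *\<^sub>v x - \<Phi> *\<^sub>v xs l"
      "finite (\<Lambda>s l)" "card (\<Lambda>s l) \<le> l"
    using omp_run_invariant[OF run \<Phi> _ before] \<Phi> x by auto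
  have xl: "xs l \<in> carrier_vec N" and sl: "supp (xs l) \<subseteq> \<Lambda>s l"
    using least_squares_carrier[OF inv(1)] least_squares_supp[OF inv(1)] \<Phi> by auto
  have d: "x - xs l \<in> carrier_vec N" using x xl by simp
  have "supp (x - xs l) \<subseteq> supp x \<union> \<Lambda>s l" using x xl sl by (auto simp: supp_def)
  then have "card (supp (x - xs l)) \<le> card (supp x \<union> \<Lambda>s l)"
    using inv(3) by (intro card_mono) (auto simp: supp_def)
  also have "\<dots> \<le> card (supp x) + card (\<Lambda>s l)" by (rule card_Un_le)
  also have "\<dots> \<le> K + 4 * D * K" using sp inv(4) l(1) by (simp add: sparse_def)
  finally have "(1 - \<delta>) * (l2_norm (x - xs l))\<^sup>2 \<le> (l2_norm (\<Phi> *\<^sub>v (x - xs l)))\<^sup>2"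
    using RIP d \<Phi> by (auto simp: RIP_def sparse_def)
  also have "\<Phi> *\<^sub>v (x - xs l) = 0\<^sub>v M"
    using mult_minus_distrib_mat_vec[OF \<Phi> x xl] inv(2) l(2) by simp
  also have "(l2_norm (0\<^sub>v M))\<^sup>2 = 0" by (simp add: l2_norm_def)
  finally have "(l2_norm (x - xs l))\<^sup>2 \<le> 0" using \<delta> by (simp add: mult_le_0_iff)
  from l2_norm_sq_eq_0[OF d this] have "x - xs l = 0\<^sub>v N" .
  then have "xs l = x" using x xl by (intro eq_vecI) (auto simp: vec_eq_iff)
  moreover have "omp_stops_at \<Phi> rs l" using l before \<Phi> by (auto simp: omp_stops_at_def)
  ultimately show ?thesis using l(1) by blast
qed

theorem theorem1:
  shows "\<exists>C c :: real. C > 0 \<and> c > 0 \<and>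
    (\<forall>(K :: nat) (M :: nat) (N :: nat) (\<Phi> :: real mat).
       0 < K \<longrightarrow> 0 < M \<longrightarrow> 0 < N \<longrightarrow> M < N \<longrightarrow>
       \<Phi> \<in> carrier_mat M N \<longrightarrow>
       (\<forall>i<N. l2_norm (col \<Phi> i) = 1) \<longrightarrow>
       RIP \<Phi> (nat \<lfloor>C * real K powr 1.2\<rfloor>) (c * real K powr (- 0.2)) \<longrightarrow>
       coherence \<Phi> \<le> 1 / (20 * real K powr 0.8) \<longrightarrow>
       (\<forall>x \<in> carrier_vec N. sparse K x \<longrightarrow>
          (\<forall>rs xs \<Lambda>s. omp_run \<Phi> (\<Phi> *\<^sub>v x) rs xs \<Lambda>s \<longrightarrow>
             (\<exists>l \<le> nat \<lfloor>C * real K powr 1.2\<rfloor>. omp_stops_at \<Phi> rs l \<and> xs l = x))))"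
proof (rule exI[of _ 49], rule exI[of _ "1 / 10"], intro conjI allI impI ballI)
  fix K M N :: nat and \<Phi> :: "real mat" and x rs xs \<Lambda>s
  assume K: "0 < K" and \<Phi>: "\<Phi> \<in> carrier_mat M N"
    and unit: "\<forall>i<N. l2_norm (col \<Phi> i) = 1"
    and RIP: "RIP \<Phi> (nat \<lfloor>49 * real K powr 1.2\<rfloor>) (1 / 10 * real K powr (- 0.2))"
    and x: "x \<in> carrier_vec N" "sparse K x"
    and run: "omp_run \<Phi> (\<Phi> *\<^sub>v x) rs xs \<Lambda>s"
  \<comment> \<open>Rounding down costs nothing, since the quantity \<open>Suc i\<close> to be
    bounded is an integer.\<close>
  define D where "D = nat \<lfloor>12 * real K powr 0.2\<rfloor>"
  have D: "Suc i \<le> D" if "2 ^ i \<le> 2 * K" for i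
    using Suc_le_powr_fifth[OF that] by (simp add: D_def le_nat_floor)
  \<comment> \<open>The constant 49 is 1 + 4 * 12: one for the sparsity of \<open>x\<close>, the
    rest for the iteration budget.\<close>
  have "real (K + 4 * D * K) = real K + 4 * real D * real K" by simp
  also have "\<dots> \<le> real K powr 1.2 + 4 * (12 * real K powr 0.2) * real K"
  proof (intro add_mono mult_right_mono mult_left_mono)
    show "real K \<le> real K powr 1.2" using powr_mono[of 1 "1.2" "real K"] K by simp
    show "real D \<le> 12 * real K powr 0.2" by (simp add: D_def)
  qed auto
  also have "\<dots> = 49 * real K powr 1.2"
    using K powr_add[of "real K" "0.2" 1] by simp
  finally have s: "K + 4 * D * K \<le> nat \<lfloor>49 * real K powr 1.2\<rfloor>" by (rule le_nat_floor)
  \<comment> \<open>The choice 1/10 gives the isometry bound required by \<open>omp_recovers\<close>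
    for every positive \<open>K\<close>.\<close>
  have "real K powr (- 0.2) \<le> 1" using powr_mono[of "- 0.2" 0 "real K"] K by simp
  then have "1 / 10 * real K powr (- 0.2) \<le> 1 / 10" by simp
  from omp_recovers[OF \<Phi> _ RIP_mono[OF RIP s] this x run D] unit
  obtain l where "l \<le> 4 * D * K" "omp_stops_at \<Phi> rs l \<and> xs l = x" by auto
  then show "\<exists>l \<le> nat \<lfloor>49 * real K powr 1.2\<rfloor>. omp_stops_at \<Phi> rs l \<and> xs l = x"
    using s by (intro exI[of _ l]) auto
qed auto

end
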